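(* For every non-singleton (nonempty) compact convex set $K\subset\mathbb{R}^n$, $$\alpha(K)=m^*(K),$$ where $\alpha(K)=\sup_{\Delta\in\mathscr{S}(K)}\rho_\Delta(K)$ is the supremum of the simplex-based measure of $K$ over all nondegenerate simplices in the direction space of $K$ with barycenter $0$, and $m^*(K)$ is the Minkowski measure of symmetry of $K$ (taken in the affine hull of $K$).
   Context: For compact convex sets $M,L\subset\mathbb{R}^n$, $\lambda_M(L):=\inf\{\lambda\ge 0:\exists x\in\mathbb{R}^n,\ L\subset x+\lambda M\}$. For a non-singleton compact convex $K\subset\mathbb{R}^n$, write $\operatorname{aff}(K)=o+E_K$ with $o\in K$ and $E_K$ a linear subspace, $k=\dim E_K$. $\mathscr{S}(K)$ is the family of $k$-dimensional (nondegenerate) simplices in $E_K$ whose barycenter (average of the $k+1$ vertices) is $0$. For $\Delta\in\mathscr{S}(K)$, $$\rho_\Delta(K):=\frac{\lambda_{-\Delta}(K)}{\lambda_\Delta(K)}.$$ For $o\in\operatorname{relint}(K)$, $m_K(o):=\inf\{\alpha\ge 1:-(K-o)\subseteq\alpha(K-o)\}$; equivalently $m_K(o)=\max_{u\in E_K,\|u\|_2=1}\frac{h_{K-o}(-u)}{h_{K-o}(u)}$, where $h_M(u)=\max_{y\in M}\langle u,y\rangle$ is the support function. The Minkowski measure is $m^*(K):=\inf_{o\in\operatorname{relint}(K)}m_K(o)$. *)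

theory Defs
  imports "HOL-Analysis.Analysis"
begin

text \<open>
  All infima and suprema are taken in \<open>ereal\<close>, so that the infimum of the empty set is
  \<open>\<infinity>\<close> and an unbounded supremum is \<open>\<infinity>\<close>; no value depends on the
  convention for \<open>Inf\<close> and \<open>Sup\<close> of such sets of reals.
\<close>

definition covering_factor :: "'a::euclidean_space set \<Rightarrow> 'a set \<Rightarrow> ereal"
  where "covering_factor M L =
    (INF l \<in> {l::real. l \<ge> 0 \<and> (\<exists>x. L \<subseteq> (\<lambda>m. x + l *\<^sub>R m) ` M)}. ereal l)"

definition direction_space :: "'a::euclidean_space set \<Rightarrow> 'a set"
  where "direction_space K = {x - y |x y. x \<in> affine hull K \<and> y \<in> affine hull K}"

text \<open>The direction space is the linear subspace parallel to the affine hull, obtained by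
  translating along any base point.\<close>

lemma direction_space_eq_translation:
  assumes "p \<in> affine hull K"
  shows "direction_space K = (\<lambda>x. x - p) ` (affine hull K)"
proof -
  have "x - y + p \<in> affine hull K" if "x \<in> affine hull K" "y \<in> affine hull K" for x y
    using mem_affine_3_minus[OF affine_affine_hull assms that, of 1]
    by (simp add: algebra_simps)
  then have "x - y \<in> (\<lambda>x. x - p) ` (affine hull K)"
    if "x \<in> affine hull K" "y \<in> affine hull K" for x y
    using that by (intro image_eqI[of _ _ "x - y + p"]) auto
  with assms show ?thesis
    by (auto simp: direction_space_def)
qed

lemma affine_hull_eq_direction_space:
  assumes "p \<in> K"
  shows "affine hull K = (+) p ` direction_space K"
proof -
  have "p \<in> affine hull K"
    using assms by (rule hull_inc)
  then show ?thesis
    by (simp add: direction_space_eq_translation image_image)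
qed

lemma subspace_direction_space:
  assumes "K \<noteq> {}"
  shows "subspace (direction_space K)"
proof -
  obtain p where "p \<in> affine hull K"
    using assms hull_inc by fastforce
  then show ?thesis
    using affine_diffs_subspace_subtract[OF affine_affine_hull, of p K]
    by (simp add: direction_space_eq_translation)
qed

lemma dim_direction_space:
  assumes "K \<noteq> {}"
  shows "int (dim (direction_space K)) = aff_dim K"
proof -
  obtain p where "p \<in> K"
    using assms by blast
  then have "affine_parallel (direction_space K) (affine hull K)"
    unfolding affine_parallel_def using affine_hull_eq_direction_space by blast
  then show ?thesis
    using aff_dim_parallel_subspace[OF assms subspace_direction_space[OF assms]]
    by (simp add: affine_parallel_commute)
qed

text \<open>The vertices of a simplex are its extreme points.\<close>

definition barycenter :: "'a::euclidean_space set \<Rightarrow> 'a"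
  where "barycenter S =
    (let V = {v. v extreme_point_of S} in (1 / real (card V)) *\<^sub>R (\<Sum>v\<in>V. v))"

lemma barycenter_convex_hull:
  assumes "\<not> affine_dependent V"
  shows "barycenter (convex hull V) = (1 / real (card V)) *\<^sub>R (\<Sum>v\<in>V. v)"
  using extreme_point_of_convex_hull_affine_independent[OF assms]
  by (simp add: barycenter_def)

definition centered_simplices :: "'a::euclidean_space set \<Rightarrow> 'a set set"
  where "centered_simplices K =
    {S. int (dim (direction_space K)) simplex S \<and> S \<subseteq> direction_space K \<and> barycenter S = 0}"

definition simplex_ratio :: "'a::euclidean_space set \<Rightarrow> 'a set \<Rightarrow> ereal"
  where "simplex_ratio S K = covering_factor (uminus ` S) K / covering_factor S K"

definition simplex_measure :: "'a::euclidean_space set \<Rightarrow> ereal"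
  where "simplex_measure K = (SUP S \<in> centered_simplices K. simplex_ratio S K)"

definition minkowski_ratio :: "'a::euclidean_space set \<Rightarrow> 'a \<Rightarrow> ereal"
  where "minkowski_ratio K p =
    (INF a \<in> {a::real. a \<ge> 1 \<and> (\<lambda>x. - (x - p)) ` K \<subseteq> (\<lambda>x. a *\<^sub>R (x - p)) ` K}. ereal a)"

definition minkowski_measure :: "'a::euclidean_space set \<Rightarrow> ereal"
  where "minkowski_measure K = (INF p \<in> rel_interior K. minkowski_ratio K p)"

end

theory Submission
  imports Defs
begin

text \<open>
  Write \<open>h\<close> for the support function of \<open>K\<close>, \<open>E\<close> for its direction space and \<open>k = dim E\<close>.

  One inequality is elementary. If \<open>-(K - p) \<subseteq> a(K - p)\<close>, then reflection in \<open>p\<close> turns a covering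
  of \<open>K\<close> by a translate of \<open>l D\<close> into a covering of \<open>K\<close> by a translate of \<open>a l (-D)\<close>, so the ratio
  of every simplex \<open>D\<close> is at most \<open>a\<close> (\<open>simplex_ratio_le_minkowski_ratio\<close>).

  For the other inequality both sides are expressed through \<open>h\<close>. A centred simplex has outer facet
  normals \<open>v_0, ..., v_k\<close> that sum to \<open>0\<close> when they are normalised so that the simplex is
  \<open>{y \<in> E. v_t \<bullet> y \<le> 1 for all t}\<close>. A translate of \<open>l D\<close> covers \<open>K\<close> iff the \<open>k + 1\<close> facet
  inequalities can be satisfied, and adding them eliminates the translation; hence the
  covering factor of \<open>K\<close> is the mean of the \<open>h(v_t)\<close>, and the ratio of the simplex is
  \<open>(\<Sum>t. h(-v_t)) / (\<Sum>t. h(v_t))\<close> (\<open>simplex_ratio_eq\<close>).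
  On the other side, \<open>K\<close> has a centre of ratio at most \<open>a\<close> as soon as some \<open>x\<close> satisfies
  \<open>h(-u) - a h(u) \<le> x \<bullet> u\<close> for all \<open>u \<in> E\<close> (\<open>minkowski_ratio_le_of_majorant\<close>).

  These are linked by convex duality. If there is no such \<open>x\<close>, then separation in \<open>E \<times> \<real>\<close> yields
  finitely many directions with a vanishing convex combination along which \<open>h(-u) - a h(u)\<close> has
  nonnegative mean (\<open>linear_majorant_or_balanced_weights\<close>). Replacing \<open>a\<close> by a smaller \<open>b\<close> makes
  the mean positive. The directions can then be thinned out to an affinely independent set,
  completed to an affine basis of \<open>E\<close>, and perturbed so that every weight is positive; the
  weighted directions are now the facet normals of a centred simplex whose ratio exceeds \<open>b\<close>
  (\<open>exists_simplex_with_large_ratio\<close>). Thus no number lies strictly between the two measures.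
\<close>

section \<open>Support functions\<close>

definition support_function :: "'a::euclidean_space set \<Rightarrow> 'a \<Rightarrow> real"
  where "support_function K u = (SUP x\<in>K. u \<bullet> x)"

lemma bdd_above_inner_image:
  assumes "compact K"
  shows "bdd_above ((\<bullet>) u ` K)"
  by (intro bounded_imp_bdd_above compact_imp_bounded compact_continuous_image assms
      continuous_intros)

lemma inner_le_support_function:
  assumes "compact K" "x \<in> K"
  shows "u \<bullet> x \<le> support_function K u"
  unfolding support_function_def by (intro cSUP_upper assms bdd_above_inner_image)

lemma support_function_least:
  assumes "K \<noteq> {}" "\<And>x. x \<in> K \<Longrightarrow> u \<bullet> x \<le> b"
  shows "support_function K u \<le> b"
  unfolding support_function_def using assms by (intro cSUP_least)

lemma support_function_scaleR:
  assumes "compact K" "K \<noteq> {}" "0 \<le> c"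
  shows "support_function K (c *\<^sub>R u) = c * support_function K u"
proof (cases "c = 0")
  case True
  with assms show ?thesis by (simp add: support_function_def)
next
  case False
  with assms have c: "0 < c" by simp
  show ?thesis
  proof (rule antisym)
    show "support_function K (c *\<^sub>R u) \<le> c * support_function K u"
      using assms by (intro support_function_least) (simp_all add: inner_le_support_function mult_left_mono)
    have "support_function K u \<le> support_function K (c *\<^sub>R u) / c"
      using assms c inner_le_support_function[of K _ "c *\<^sub>R u"]
      by (intro support_function_least) (simp_all add: pos_le_divide_eq mult.commute)
    then show "c * support_function K u \<le> support_function K (c *\<^sub>R u)"
      using c by (simp add: pos_le_divide_eq mult.commute)
  qed
qed

lemma continuous_on_support_function:
  assumes "compact K" "K \<noteq> {}"
  shows "continuous_on UNIV (support_function K)"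
proof (intro convex_on_continuous open_UNIV convex_onI convex_UNIV)
  fix t :: real and x y :: 'a
  assume t: "0 < t" "t < 1"
  show "support_function K ((1 - t) *\<^sub>R x + t *\<^sub>R y)
    \<le> (1 - t) * support_function K x + t * support_function K y"
    using t assms
    by (intro support_function_least)
       (auto simp: inner_add_left intro!: add_mono mult_left_mono inner_le_support_function)
qed

text \<open>The directions sum to zero, so their inner products with a fixed point of the set sum to zero
  too, and each is at most the support in that direction. If one direction separates \<open>x\<close> from
  \<open>y\<close>, then one of these two points does not attain the support there.\<close>

lemma support_function_sum_pos:
  assumes "compact K" "finite T" "(\<Sum>t\<in>T. v t) = 0"
    and "t \<in> T" "x \<in> K" "y \<in> K" "v t \<bullet> x \<noteq> v t \<bullet> y"
  shows "0 < (\<Sum>t\<in>T. support_function K (v t))"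
proof -
  obtain z where z: "z \<in> K" "v t \<bullet> z < support_function K (v t)"
  proof (cases "v t \<bullet> x < v t \<bullet> y")
    case True
    with that[of x] show ?thesis
      using assms inner_le_support_function[of K y "v t"] by fastforce
  next
    case False
    with that[of y] show ?thesis
      using assms inner_le_support_function[of K x "v t"] by fastforce
  qed
  have "0 = (\<Sum>t\<in>T. v t \<bullet> z)"
    using assms(3) by (simp flip: inner_sum_left)
  also have "\<dots> < (\<Sum>t\<in>T. support_function K (v t))"
    using assms z inner_le_support_function[OF assms(1) z(1)]
    by (intro sum_strict_mono_ex1) auto
  finally show ?thesis .
qed

section \<open>Subspaces and affinely independent sets\<close>

lemma inner_represented_in_subspace:
  fixes w :: "'a::euclidean_space"
  assumes "subspace E"
  obtains w' where "w' \<in> E" "\<And>u. u \<in> E \<Longrightarrow> u \<bullet> w' = u \<bullet> w"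
proof -
  obtain y z where "y \<in> span E" "\<And>u. u \<in> span E \<Longrightarrow> orthogonal z u" "w = y + z"
    using orthogonal_subspace_decomp_exists[of E w] by metis
  moreover from this have "u \<bullet> y = u \<bullet> w" if "u \<in> E" for u
    using that span_base[of u E] by (simp add: orthogonal_def inner_add_right inner_commute)
  ultimately show ?thesis
    using that assms span_eq_iff by blast
qed

lemma affine_interpolation:
  fixes T :: "'a::euclidean_space set"
  assumes "\<not> affine_dependent T"
  obtains w b where "\<And>t. t \<in> T \<Longrightarrow> t \<bullet> w + b = r t"
proof (cases "T = {}")
  case True
  with that show ?thesis by blast
next
  case False
  then obtain a where a: "a \<in> T" by blast
  let ?B = "(\<lambda>x. - a + x) ` (T - {a})"
  have "independent ?B"
    using assms affine_dependent_iff_dependent2[OF a] by blast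
  then obtain g :: "'a \<Rightarrow> real" where g: "linear g" "\<forall>x\<in>?B. g x = r (a + x) - r a"
    using linear_independent_extend[of ?B "\<lambda>x. r (a + x) - r a"] by blast
  have adj: "x \<bullet> adjoint g 1 = g x" for x
    using adjoint_works[OF g(1), of x 1] by simp
  have "g t - g a = r t - r a" if "t \<in> T" for t
  proof (cases "t = a")
    case False
    with that have "- a + t \<in> ?B" by blast
    with g(2) have "g (- a + t) = r (a + (- a + t)) - r a" by blast
    then show ?thesis
      using linear_add[OF g(1), of "- a" t] linear_neg[OF g(1), of a] by simp
  qed simp
  then have "t \<bullet> adjoint g 1 + (r a - g a) = r t" if "t \<in> T" for t
    using that by (simp add: adj algebra_simps)
  then show ?thesis using that by blast
qed

text \<open>A vanishing weighted sum over affinely dependent points can be moved along an affine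
  relation, in the direction that does not decrease the objective, until a weight vanishes.
  Caratheodory's theorem for the points \<open>(s, g s)\<close> would leave one point too many; keeping only
  the sign of the objective saves that point.\<close>

lemma affinely_independent_support:
  fixes S :: "'a::real_vector set" and g :: "'a \<Rightarrow> real"
  assumes "finite S" "\<And>s. s \<in> S \<Longrightarrow> 0 \<le> l s" "sum l S = 1" "(\<Sum>s\<in>S. l s *\<^sub>R s) = 0"
    and "0 < (\<Sum>s\<in>S. l s * g s)"
  shows "\<exists>S' l'. S' \<subseteq> S \<and> \<not> affine_dependent S' \<and> (\<forall>s\<in>S'. 0 \<le> l' s) \<and> sum l' S' = 1 \<and>
    (\<Sum>s\<in>S'. l' s *\<^sub>R s) = 0 \<and> 0 < (\<Sum>s\<in>S'. l' s * g s)"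
  using assms
proof (induction "card S" arbitrary: S l rule: less_induct)
  case less
  show ?case
  proof (cases "affine_dependent S")
    case False
    with less.prems show ?thesis by blast
  next
    case True
    then obtain m0 where m0: "sum m0 S = 0" "\<exists>v\<in>S. m0 v \<noteq> 0" "(\<Sum>v\<in>S. m0 v *\<^sub>R v) = 0"
      using affine_dependent_explicit_finite[OF less.prems(1)] by blast
    define c :: real where "c = (if 0 \<le> (\<Sum>v\<in>S. m0 v * g v) then 1 else - 1)"
    define m where "m = (\<lambda>v. c * m0 v)"
    have "(\<Sum>v\<in>S. m v *\<^sub>R v) = c *\<^sub>R (\<Sum>v\<in>S. m0 v *\<^sub>R v)"
      by (simp add: m_def scaleR_sum_right)
    moreover have "sum m S = c * sum m0 S" "(\<Sum>v\<in>S. m v * g v) = c * (\<Sum>v\<in>S. m0 v * g v)"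
      by (simp_all add: m_def sum_distrib_left mult.assoc)
    moreover have "c \<noteq> 0" "0 \<le> c * (\<Sum>v\<in>S. m0 v * g v)"
      by (simp_all add: c_def)
    ultimately have m: "sum m S = 0" "\<exists>v\<in>S. m v \<noteq> 0" "(\<Sum>v\<in>S. m v *\<^sub>R v) = 0"
        "0 \<le> (\<Sum>v\<in>S. m v * g v)"
      using m0 by (simp_all add: m_def)
    define N where "N = {v\<in>S. m v < 0}"
    have "N \<noteq> {}"
    proof
      assume "N = {}"
      then have "\<forall>v\<in>S. 0 \<le> m v" by (auto simp: N_def not_less)
      with m(1,2) less.prems(1) show False
        using sum_nonneg_eq_0_iff by blast
    qed
    moreover have "finite N" using less.prems(1) by (simp add: N_def)
    ultimately obtain v where "is_arg_min (\<lambda>s. l s / - m s) (\<lambda>s. s \<in> N) v"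
      using ex_is_arg_min_if_finite by blast
    then have v: "v \<in> N" "\<And>s. s \<in> N \<Longrightarrow> l v / - m v \<le> l s / - m s"
      by (simp_all add: is_arg_min_linorder)
    define t where "t = l v / - m v"
    define l' where "l' = (\<lambda>s. l s + t * m s)"
    have vS: "v \<in> S" "m v < 0" using v(1) by (auto simp: N_def)
    have t: "0 \<le> t" using less.prems(2)[OF vS(1)] vS(2) by (simp add: t_def divide_nonneg_neg)
    have nonneg: "0 \<le> l' s" if "s \<in> S" for s
    proof (cases "m s < 0")
      case True
      with that v(2)[of s] have "t \<le> l s / - m s" by (simp add: t_def N_def)
      with True have "t * - m s \<le> l s" by (subst (asm) pos_le_divide_eq) simp_all
      then show ?thesis by (simp add: l'_def)
    next
      case False
      with t less.prems(2)[OF that] show ?thesis by (simp add: l'_def)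
    qed
    have zero: "l' v = 0" using vS by (simp add: l'_def t_def)
    have sums: "sum l' S = sum l S + t * sum m S"
      "(\<Sum>s\<in>S. l' s *\<^sub>R s) = (\<Sum>s\<in>S. l s *\<^sub>R s) + t *\<^sub>R (\<Sum>s\<in>S. m s *\<^sub>R s)"
      "(\<Sum>s\<in>S. l' s * g s) = (\<Sum>s\<in>S. l s * g s) + t * (\<Sum>s\<in>S. m s * g s)"
      by (simp_all add: l'_def sum.distrib sum_distrib_left scaleR_sum_right scaleR_add_left
          distrib_right mult.assoc)
    have "\<exists>S' l''. S' \<subseteq> S - {v} \<and> \<not> affine_dependent S' \<and> (\<forall>s\<in>S'. 0 \<le> l'' s) \<and> sum l'' S' = 1 \<and>
      (\<Sum>s\<in>S'. l'' s *\<^sub>R s) = 0 \<and> 0 < (\<Sum>s\<in>S'. l'' s * g s)"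
    proof (rule less.hyps[of _ l'])
      show "card (S - {v}) < card S" using less.prems(1) vS(1) by (rule card_Diff1_less)
      show "finite (S - {v})" using less.prems(1) by simp
      show "0 \<le> l' s" if "s \<in> S - {v}" for s using that nonneg by blast
      show "sum l' (S - {v}) = 1"
        using sums(1) less.prems(1,3) m(1) vS(1) zero by (simp add: sum_diff1)
      show "(\<Sum>s\<in>S - {v}. l' s *\<^sub>R s) = 0"
        using sums(2) less.prems(1,4) m(3) vS(1) zero by (simp add: sum_diff1)
      show "0 < (\<Sum>s\<in>S - {v}. l' s * g s)"
        using sums(3) less.prems(1,5) m(4) t vS(1) zero by (simp add: sum_diff1 add_pos_nonneg)
    qed
    then show ?thesis by blast
  qed
qed

section \<open>Simplices given by facet normals\<close>

text \<open>The vertex \<open>w s\<close> lies on all facets \<open>{y. v t \<bullet> y = 1}\<close> with \<open>t \<noteq> s\<close>; as the normals are balanced,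
  its remaining inner product is forced to be \<open>1 - card T\<close>. Giving normals and vertices together
  in this form makes the passage to the opposite simplex a mere change of signs.\<close>

locale facet_normals =
  fixes E :: "'a::euclidean_space set" and T :: "'i set" and v w :: "'i \<Rightarrow> 'a"
  assumes subspace: "subspace E"
    and finite_index: "finite T" and index_nonempty: "T \<noteq> {}"
    and vertex_in: "\<And>s. s \<in> T \<Longrightarrow> w s \<in> E"
    and sum_normals: "(\<Sum>t\<in>T. v t) = 0"
    and normal_vertex: "\<And>s t. s \<in> T \<Longrightarrow> t \<in> T \<Longrightarrow> v t \<bullet> w s = 1 - (if s = t then real (card T) else 0)"
    and normals_separate: "\<And>y. y \<in> E \<Longrightarrow> (\<And>t. t \<in> T \<Longrightarrow> v t \<bullet> y = 0) \<Longrightarrow> y = 0"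
begin

lemma card_pos: "0 < real (card T)"
  using finite_index index_nonempty by (simp add: card_gt_0_iff)

lemma inner_combination:
  assumes "t \<in> T"
  shows "v t \<bullet> (\<Sum>s\<in>T. c s *\<^sub>R w s) = sum c T - real (card T) * c t"
proof -
  have "v t \<bullet> (\<Sum>s\<in>T. c s *\<^sub>R w s) = (\<Sum>s\<in>T. c s - (if s = t then real (card T) * c s else 0))"
    using assms by (auto simp: inner_sum_right normal_vertex algebra_simps intro!: sum.cong)
  also have "\<dots> = sum c T - real (card T) * c t"
    using assms finite_index by (simp add: sum_subtractf)
  finally show ?thesis .
qed

lemma combination_in: "(\<Sum>s\<in>T. c s *\<^sub>R w s) \<in> E"
  using subspace vertex_in by (intro subspace_sum subspace_scale)

lemma sum_inner_normals: "(\<Sum>s\<in>T. v s \<bullet> z) = 0"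
  by (simp only: inner_sum_left[symmetric] sum_normals inner_zero_left)

lemma sum_coordinates: "(\<Sum>s\<in>T. (l - v s \<bullet> z) / real (card T)) = l"
  using card_pos
  by (simp only: sum_divide_distrib[symmetric]) (simp add: sum_subtractf sum_inner_normals)

text \<open>The coefficients sum to \<open>l\<close>. For \<open>l = 1\<close> they are the barycentric coordinates of \<open>z\<close>, and they
  are nonnegative exactly when \<open>z\<close> satisfies the facet inequalities scaled by \<open>l\<close>.\<close>

lemma eq_combination:
  assumes "z \<in> E"
  shows "z = (\<Sum>s\<in>T. ((l - v s \<bullet> z) / real (card T)) *\<^sub>R w s)"
proof -
  let ?y = "\<Sum>s\<in>T. ((l - v s \<bullet> z) / real (card T)) *\<^sub>R w s"
  have "z - ?y = 0"
  proof (rule normals_separate)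
    show "z - ?y \<in> E" by (intro subspace_diff subspace combination_in assms)
    show "v t \<bullet> (z - ?y) = 0" if "t \<in> T" for t
      using that card_pos by (simp add: inner_diff_right inner_combination sum_coordinates)
  qed
  then show ?thesis by simp
qed

lemma sum_vertices: "(\<Sum>s\<in>T. w s) = 0"
proof (rule normals_separate)
  show "(\<Sum>s\<in>T. w s) \<in> E" using combination_in[of "\<lambda>_. 1"] by simp
  show "v t \<bullet> (\<Sum>s\<in>T. w s) = 0" if "t \<in> T" for t
    using inner_combination[OF that, of "\<lambda>_. 1"] by simp
qed

lemma inj_on_vertices: "inj_on w T"
proof (rule inj_onI)
  fix s t assume st: "s \<in> T" "t \<in> T" "w s = w t"
  then show "s = t"
    using normal_vertex[OF st(1,1)] normal_vertex[OF st(2,1)] card_pos by (cases "s = t") simp_all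
qed

lemma affine_independent_vertices: "\<not> affine_dependent (w ` T)"
proof
  assume "affine_dependent (w ` T)"
  then obtain U where U: "sum U (w ` T) = 0" "\<exists>x\<in>w ` T. U x \<noteq> 0" "(\<Sum>x\<in>w ` T. U x *\<^sub>R x) = 0"
    using finite_index by (auto simp: affine_dependent_explicit_finite)
  then have "(\<Sum>s\<in>T. U (w s)) = 0" "(\<Sum>s\<in>T. U (w s) *\<^sub>R w s) = 0"
    by (simp_all add: sum.reindex inj_on_vertices)
  then have "U (w t) = 0" if "t \<in> T" for t
    using inner_combination[OF that, of "\<lambda>s. U (w s)"] card_pos by simp
  with U(2) show False by blast
qed

abbreviation simplex_set where "simplex_set \<equiv> convex hull (w ` T)"

lemma simplex_in_centered_simplices:
  assumes "direction_space K = E" "card T = Suc (dim E)"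
  shows "simplex_set \<in> centered_simplices K"
proof -
  have "int (dim E) simplex simplex_set"
    unfolding simplex_def
    using affine_independent_vertices inj_on_vertices assms by (auto simp: card_image)
  moreover have "simplex_set \<subseteq> E"
    using vertex_in subspace by (intro hull_minimal subspace_imp_convex) auto
  moreover have "barycenter simplex_set = 0"
    by (simp add: barycenter_convex_hull affine_independent_vertices sum.reindex inj_on_vertices
        sum_vertices)
  ultimately show ?thesis
    using assms by (simp add: centered_simplices_def)
qed

lemma in_scaled_simplex:
  assumes "z \<in> E" "0 < l" "\<And>t. t \<in> T \<Longrightarrow> v t \<bullet> z \<le> l"
  shows "z \<in> (\<lambda>m. l *\<^sub>R m) ` simplex_set"
proof
  define c where "c = (\<lambda>s. (1 - v s \<bullet> z / l) / real (card T))"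
  have "(1 / l) *\<^sub>R z \<in> E" using subspace assms(1) by (rule subspace_scale)
  from eq_combination[OF this, of 1]
  have "(1 / l) *\<^sub>R z = (\<Sum>s\<in>T. c s *\<^sub>R w s)"
    by (simp add: c_def)
  moreover have "(\<Sum>s\<in>T. c s *\<^sub>R w s) \<in> simplex_set"
  proof (rule convex_sum)
    show "sum c T = 1"
      using sum_coordinates[of 1 "(1 / l) *\<^sub>R z"] by (simp add: c_def)
    show "0 \<le> c t" if "t \<in> T" for t
      using assms that by (simp add: c_def)
  qed (auto simp: finite_index intro: hull_inc)
  ultimately show "(1 / l) *\<^sub>R z \<in> simplex_set" by simp
  show "z = l *\<^sub>R ((1 / l) *\<^sub>R z)" using assms(2) by simp
qed

lemma inner_le_on_simplex:
  assumes "m \<in> simplex_set" "t \<in> T"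
  shows "v t \<bullet> m \<le> 1"
proof -
  have "simplex_set \<subseteq> {x. v t \<bullet> x \<le> 1}"
    using assms normal_vertex by (intro hull_minimal convex_halfspace_le) auto
  with assms show ?thesis by blast
qed

text \<open>Adding the facet inequalities of a covering translate eliminates the translation and bounds the
  factor from below; there are as many facets as unknowns in the translation and the factor
  together, so some translate satisfies all facet inequalities with equality.\<close>

lemma covering_factor_simplex:
  assumes "compact K" "p \<in> K" "q \<in> K" "p \<noteq> q" and E: "\<And>x y. x \<in> K \<Longrightarrow> y \<in> K \<Longrightarrow> x - y \<in> E"
  shows "0 < (\<Sum>t\<in>T. support_function K (v t))"
    and "covering_factor simplex_set K = ereal ((\<Sum>t\<in>T. support_function K (v t)) / real (card T))"
proof -
  let ?h = "support_function K"
  let ?l = "(\<Sum>t\<in>T. ?h (v t)) / real (card T)"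
  obtain t where "t \<in> T" "v t \<bullet> (p - q) \<noteq> 0"
    using normals_separate[OF E[OF assms(2,3)]] assms(4) by auto
  then show pos: "0 < (\<Sum>t\<in>T. ?h (v t))"
    using support_function_sum_pos[OF assms(1) finite_index sum_normals _ assms(2,3)]
    by (simp add: inner_diff_right)
  have lower: "?l \<le> l" if l: "0 \<le> l" "K \<subseteq> (\<lambda>m. x + l *\<^sub>R m) ` simplex_set" for l x
  proof -
    have "?h (v t) \<le> v t \<bullet> x + l" if "t \<in> T" for t
    proof (rule support_function_least)
      show "K \<noteq> {}" using assms by blast
      fix y assume "y \<in> K"
      with l(2) obtain m where m: "m \<in> simplex_set" "y = x + l *\<^sub>R m" by blast
      have "l * (v t \<bullet> m) \<le> l * 1"
        using l(1) inner_le_on_simplex[OF m(1) that] by (rule mult_left_mono[rotated])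
      then show "v t \<bullet> y \<le> v t \<bullet> x + l"
        by (simp add: m(2) inner_add_right)
    qed
    then have "(\<Sum>t\<in>T. ?h (v t)) \<le> (\<Sum>t\<in>T. v t \<bullet> x + l)"
      by (rule sum_mono)
    also have "\<dots> = real (card T) * l"
      by (simp add: sum.distrib sum_inner_normals)
    finally show ?thesis
      using card_pos by (simp add: pos_divide_le_eq mult.commute)
  qed
  (* The translate is chosen so that all facets of the scaled simplex touch K. *)
  define c where "c = (\<lambda>s. (v s \<bullet> p - ?h (v s)) / real (card T))"
  define x where "x = (\<Sum>s\<in>T. c s *\<^sub>R w s)"
  have "sum c T = - ?l"
    unfolding c_def sum_divide_distrib[symmetric] by (simp add: sum_subtractf sum_inner_normals)
  then have x: "v t \<bullet> x = ?h (v t) - v t \<bullet> p - ?l" if "t \<in> T" for t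
    using that card_pos by (simp add: x_def inner_combination c_def)
  have "K \<subseteq> (\<lambda>m. (p + x) + ?l *\<^sub>R m) ` simplex_set"
  proof
    fix y assume y: "y \<in> K"
    have "y - p - x \<in> (\<lambda>m. ?l *\<^sub>R m) ` simplex_set"
    proof (rule in_scaled_simplex)
      show "y - p - x \<in> E"
        unfolding x_def by (intro subspace_diff subspace combination_in E y assms(2))
      show "0 < ?l" using pos card_pos by simp
      show "v t \<bullet> (y - p - x) \<le> ?l" if "t \<in> T" for t
        using inner_le_support_function[OF assms(1) y, of "v t"]
        by (simp add: inner_diff_right x[OF that])
    qed
    then obtain m where "m \<in> simplex_set" "y - p - x = ?l *\<^sub>R m" by blast
    then show "y \<in> (\<lambda>m. (p + x) + ?l *\<^sub>R m) ` simplex_set"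
      by (intro image_eqI[of _ _ m]) (auto simp: algebra_simps)
  qed
  with pos show "covering_factor simplex_set K = ereal ?l"
    unfolding covering_factor_def
    by (intro antisym INF_greatest INF_lower) (use lower in auto)
qed

lemma facet_normals_uminus: "facet_normals E T (\<lambda>t. - v t) (\<lambda>t. - w t)"
  using subspace finite_index index_nonempty vertex_in sum_normals normal_vertex normals_separate
  by unfold_locales (auto simp: sum_negf subspace_neg)

lemma simplex_ratio_eq:
  assumes "compact K" "p \<in> K" "q \<in> K" "p \<noteq> q" and "\<And>x y. x \<in> K \<Longrightarrow> y \<in> K \<Longrightarrow> x - y \<in> E"
  shows "simplex_ratio simplex_set K =
    ereal ((\<Sum>t\<in>T. support_function K (- v t)) / (\<Sum>t\<in>T. support_function K (v t)))"
proof -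
  interpret neg: facet_normals E T "\<lambda>t. - v t" "\<lambda>t. - w t"
    by (rule facet_normals_uminus)
  have "uminus ` simplex_set = neg.simplex_set"
    using convex_hull_linear_image[OF module_hom_uminus, of "w ` T"] by (simp add: image_image)
  then show ?thesis
    using covering_factor_simplex[OF assms] neg.covering_factor_simplex[OF assms] card_pos
    by (simp add: simplex_ratio_def)
qed

end

section \<open>From balanced directions to centred simplices\<close>

text \<open>An affine basis with positive weights becomes a system of facet normals once it is recentred
  at the weighted mean; the vertices are found by affine interpolation of the required values.\<close>

lemma facet_normals_of_affine_basis:
  fixes T :: "'a::euclidean_space set"
  assumes "subspace E" "\<not> affine_dependent T" "affine hull T = E"
    and pos: "\<And>t. t \<in> T \<Longrightarrow> 0 < l t" and sum1: "sum l T = 1"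
  shows "\<exists>w. facet_normals E T (\<lambda>t. l t *\<^sub>R (t - (\<Sum>t\<in>T. l t *\<^sub>R t))) w"
proof -
  define c where "c = (\<Sum>t\<in>T. l t *\<^sub>R t)"
  have fin: "finite T" using assms(2) by (rule aff_independent_finite)
  have ne: "T \<noteq> {}" using sum1 by auto
  have TE: "T \<subseteq> E" using hull_subset[of T affine] assms(3) by simp
  have cE: "c \<in> E"
    unfolding c_def using assms(1) TE by (intro subspace_sum subspace_scale) auto
  have "\<exists>x. x \<in> E \<and> (\<forall>t\<in>T. l t * ((t - c) \<bullet> x) = 1 - (if s = t then real (card T) else 0))"
    if s: "s \<in> T" for s
  proof -
    define r where "r = (\<lambda>t. (1 - (if s = t then real (card T) else 0)) / l t)"
    obtain x b where x: "\<And>t. t \<in> T \<Longrightarrow> t \<bullet> x + b = r t"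
      using affine_interpolation[OF assms(2)] by metis
    (* The prescribed values have weighted mean 0, so the interpolant vanishes at c. *)
    have "c \<bullet> x + b = (\<Sum>t\<in>T. l t * (t \<bullet> x + b))"
      using sum1 by (simp add: c_def inner_sum_left distrib_left sum.distrib flip: sum_distrib_right)
    also have "\<dots> = (\<Sum>t\<in>T. 1 - (if s = t then real (card T) else 0))"
      using pos by (intro sum.cong) (auto simp: x r_def less_imp_neq[THEN not_sym])
    also have "\<dots> = 0"
      using s fin by (simp add: sum_subtractf)
    finally have c0: "c \<bullet> x + b = 0" .
    obtain x' where x': "x' \<in> E" "\<And>u. u \<in> E \<Longrightarrow> u \<bullet> x' = u \<bullet> x"
      using inner_represented_in_subspace[OF assms(1)] by metis
    have "l t * ((t - c) \<bullet> x') = 1 - (if s = t then real (card T) else 0)" if t: "t \<in> T" for t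
    proof -
      have "t - c \<in> E" using TE t cE assms(1) by (auto intro: subspace_diff)
      then have "(t - c) \<bullet> x' = (t - c) \<bullet> x" by (rule x')
      also have "\<dots> = r t" using x[OF t] c0 by (simp add: inner_diff_left)
      finally show ?thesis using pos[OF t] by (simp add: r_def)
    qed
    with x'(1) show ?thesis by blast
  qed
  then obtain w where w: "\<And>s. s \<in> T \<Longrightarrow> w s \<in> E"
    "\<And>s t. s \<in> T \<Longrightarrow> t \<in> T \<Longrightarrow> l t * ((t - c) \<bullet> w s) = 1 - (if s = t then real (card T) else 0)"
    by metis
  have "y = 0" if y: "y \<in> E" "\<And>t. t \<in> T \<Longrightarrow> (l t *\<^sub>R (t - c)) \<bullet> y = 0" for y
  proof -
    have "y \<bullet> t = y \<bullet> c" if "t \<in> T" for t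
    proof -
      have "(t - c) \<bullet> y = 0" using y(2)[OF that] pos[OF that] by simp
      then have "t \<bullet> y = c \<bullet> y" by (simp add: inner_diff_left)
      then show ?thesis by (simp add: inner_commute)
    qed
    then have "T \<subseteq> {x. y \<bullet> x = y \<bullet> c}" by blast
    then have "affine hull T \<subseteq> {x. y \<bullet> x = y \<bullet> c}"
      by (intro hull_minimal affine_hyperplane)
    with assms(1,3) y(1) have "y \<bullet> y = y \<bullet> c" "y \<bullet> 0 = y \<bullet> c"
      using subspace_0 by blast+
    then show "y = 0" by simp
  qed
  moreover have "(\<Sum>t\<in>T. l t *\<^sub>R (t - c)) = 0"
    using sum1 by (simp add: c_def scaleR_diff_right sum_subtractf flip: scaleR_sum_left)
  ultimately have "facet_normals E T (\<lambda>t. l t *\<^sub>R (t - c)) w"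
    using assms(1) fin ne w by unfold_locales auto
  then show ?thesis unfolding c_def by blast
qed

text \<open>Vanishing weights are the degenerate case, in which the points of positive weight span only a
  proper subspace. Mixing in uniform weights and recentring moves the normals slightly without losing
  their affine independence, and the strict inequality survives by continuity.\<close>

lemma positive_weights:
  fixes T :: "'a::euclidean_space set" and g :: "'a \<Rightarrow> real"
  assumes "finite T" "\<And>t. t \<in> T \<Longrightarrow> 0 \<le> l t" "sum l T = 1" "(\<Sum>t\<in>T. l t *\<^sub>R t) = 0"
    and "0 < (\<Sum>t\<in>T. l t * g t)" and "continuous_on UNIV g"
  shows "\<exists>l'. (\<forall>t\<in>T. 0 < l' t) \<and> sum l' T = 1 \<and>
    0 < (\<Sum>t\<in>T. l' t * g (t - (\<Sum>t\<in>T. l' t *\<^sub>R t)))"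
proof -
  have ne: "0 < real (card T)" using assms(1,3) by (auto simp: card_gt_0_iff)
  define m where "m = (\<lambda>e t. (1 - e) * l t + e / real (card T))"
  define F where "F = (\<lambda>e. \<Sum>t\<in>T. m e t * g (t - (\<Sum>t\<in>T. m e t *\<^sub>R t)))"
  have m: "continuous_on UNIV (\<lambda>e. m e t)" for t
    unfolding m_def using ne by (intro continuous_intros) auto
  have "continuous_on UNIV F"
    unfolding F_def
    by (intro continuous_on_sum continuous_on_mult m continuous_on_compose2[OF assms(6)]
        continuous_on_diff continuous_on_const continuous_on_scaleR subset_UNIV)
  then have "(F \<longlongrightarrow> F 0) (at_right 0)"
    by (simp add: continuous_on_def filterlim_at_split)
  moreover have "0 < F 0"
    using assms(4,5) by (simp add: F_def m_def)
  ultimately have "eventually (\<lambda>e. 0 < F e) (at_right 0)"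
    by (rule order_tendstoD(1))
  then obtain b where b: "0 < b" "\<And>e. 0 < e \<Longrightarrow> e < b \<Longrightarrow> 0 < F e"
    unfolding eventually_at_right_field by blast
  obtain e where e: "0 < e" "e < b" "e < 1"
    using b(1) dense[of 0 "min b 1"] by auto
  have "0 < m e t" if "t \<in> T" for t
    unfolding m_def using e ne assms(2)[OF that] by (intro add_nonneg_pos) auto
  moreover have "sum (m e) T = 1"
    using assms(3) ne by (simp add: m_def sum.distrib flip: sum_distrib_left)
  ultimately show ?thesis
    using b(2)[OF e(1,2)] unfolding F_def by blast
qed

text \<open>By positive homogeneity the weights can be absorbed into the normals, which turns the
  weighted inequality into a bound for the ratio of a simplex.\<close>

lemma exists_simplex_with_large_ratio:
  fixes K :: "'a::euclidean_space set"
  assumes K: "compact K" "p \<in> K" "q \<in> K" "p \<noteq> q"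
    and S: "finite S" "S \<subseteq> direction_space K"
      "\<And>s. s \<in> S \<Longrightarrow> 0 \<le> l s" "sum l S = 1" "(\<Sum>s\<in>S. l s *\<^sub>R s) = 0"
    and gap: "0 < (\<Sum>s\<in>S. l s * (support_function K (- s) - b * support_function K s))"
  shows "\<exists>D\<in>centered_simplices K. ereal b < simplex_ratio D K"
proof -
  let ?h = "support_function K"
  define g where "g = (\<lambda>u. ?h (- u) - b * ?h u)"
  have Kne: "K \<noteq> {}" using K by blast
  define E where "E = direction_space K"
  have E: "subspace E" unfolding E_def using Kne by (rule subspace_direction_space)
  have contg: "continuous_on UNIV g"
    unfolding g_def
    by (intro continuous_intros continuous_on_compose2[OF continuous_on_support_function[OF K(1) Kne]]) auto
  obtain S' l' where S': "S' \<subseteq> S" "\<not> affine_dependent S'" "\<And>s. s \<in> S' \<Longrightarrow> 0 \<le> l' s" "sum l' S' = 1"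
      "(\<Sum>s\<in>S'. l' s *\<^sub>R s) = 0" "0 < (\<Sum>s\<in>S'. l' s * g s)"
    using affinely_independent_support[OF S(1,3,4,5), of g] gap unfolding g_def by blast
  have "S' \<noteq> {}" using S'(4) by auto
  then obtain T where T: "\<not> affine_dependent T" "S' \<subseteq> T" "T \<subseteq> E" "affine hull T = affine hull E"
    using extend_to_affine_basis_nonempty[of S' E] S' S(2) unfolding E_def by blast
  have hullT: "affine hull T = E"
    using T(4) E by (simp add: affine_hull_eq subspace_imp_affine)
  have finT: "finite T" using T(1) by (rule aff_independent_finite)
  define l0 where "l0 = (\<lambda>t. if t \<in> S' then l' t else 0)"
  have ext: "(\<Sum>t\<in>T. k (l0 t) t) = (\<Sum>s\<in>S'. k (l' s) s)" if "\<And>t. k 0 t = 0"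
    for k :: "real \<Rightarrow> 'a \<Rightarrow> 'b::comm_monoid_add"
    using that finT T(2) unfolding l0_def by (intro sum.mono_neutral_cong_right) auto
  have "\<exists>l. (\<forall>t\<in>T. 0 < l t) \<and> sum l T = 1 \<and> 0 < (\<Sum>t\<in>T. l t * g (t - (\<Sum>t\<in>T. l t *\<^sub>R t)))"
  proof (rule positive_weights[OF finT _ _ _ _ contg])
    show "0 \<le> l0 t" if "t \<in> T" for t using S'(3) by (simp add: l0_def)
    show "sum l0 T = 1" using ext[of "\<lambda>x t. x"] S'(4) by simp
    show "(\<Sum>t\<in>T. l0 t *\<^sub>R t) = 0" using ext[of "\<lambda>x t. x *\<^sub>R t"] S'(5) by simp
    show "0 < (\<Sum>t\<in>T. l0 t * g t)" using ext[of "\<lambda>x t. x * g t"] S'(6) by simp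
  qed
  then obtain l1 where l1: "\<And>t. t \<in> T \<Longrightarrow> 0 < l1 t" "sum l1 T = 1"
      "0 < (\<Sum>t\<in>T. l1 t * g (t - (\<Sum>t\<in>T. l1 t *\<^sub>R t)))"
    by blast
  define v where "v = (\<lambda>t. l1 t *\<^sub>R (t - (\<Sum>t\<in>T. l1 t *\<^sub>R t)))"
  obtain w where "facet_normals E T v w"
    using facet_normals_of_affine_basis[OF E T(1) hullT l1(1,2)] unfolding v_def by blast
  then interpret facet_normals E T v w .
  have diff: "x - y \<in> E" if "x \<in> K" "y \<in> K" for x y
    unfolding E_def direction_space_def using that hull_inc[of _ K affine] by blast
  have "l1 t * g (t - (\<Sum>t\<in>T. l1 t *\<^sub>R t)) = ?h (- v t) - b * ?h (v t)" if "t \<in> T" for t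
    using l1(1)[OF that] support_function_scaleR[OF K(1) Kne, of "l1 t"]
    by (simp add: g_def v_def right_diff_distrib flip: scaleR_minus_right)
  then have "(\<Sum>t\<in>T. l1 t * g (t - (\<Sum>t\<in>T. l1 t *\<^sub>R t)))
      = (\<Sum>t\<in>T. ?h (- v t)) - b * (\<Sum>t\<in>T. ?h (v t))"
    by (simp add: sum_subtractf sum_distrib_left cong: sum.cong)
  with l1(3) have "b * (\<Sum>t\<in>T. ?h (v t)) < (\<Sum>t\<in>T. ?h (- v t))" by simp
  then have "b < (\<Sum>t\<in>T. ?h (- v t)) / (\<Sum>t\<in>T. ?h (v t))"
    using covering_factor_simplex(1)[OF K diff] by (simp add: pos_less_divide_eq)
  then have "ereal b < simplex_ratio simplex_set K"
    using simplex_ratio_eq[OF K diff] by simp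
  moreover have "card T = Suc (dim E)"
    using aff_dim_affine_independent[OF T(1)] aff_dim_subspace[OF E] hullT aff_dim_affine_hull[of T]
    by simp
  then have "simplex_set \<in> centered_simplices K"
    using E_def by (intro simplex_in_centered_simplices) auto
  ultimately show ?thesis by blast
qed

section \<open>Duality between centres and balanced directions\<close>

text \<open>If the convex hull of the graph of \<open>f\<close> over the unit sphere meets the upward vertical ray at
  the origin, the point of intersection provides the weights. Otherwise a hyperplane separates the
  hull from the ray. It is not vertical, because the sphere is symmetric, and the hyperplane
  through the origin parallel to it is the graph of a linear functional above \<open>f\<close>.\<close>

lemma linear_majorant_or_balanced_weights:
  fixes f :: "'a::euclidean_space \<Rightarrow> real"
  assumes "subspace E" "E \<noteq> {0}" "continuous_on UNIV f"
  obtains (majorant) x where "\<And>u. u \<in> E \<Longrightarrow> norm u = 1 \<Longrightarrow> f u \<le> x \<bullet> u"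
  | (weights) S l where "finite S" "S \<subseteq> E - {0}" "\<And>s. s \<in> S \<Longrightarrow> 0 \<le> l s" "sum l S = 1"
      "(\<Sum>s\<in>S. l s *\<^sub>R s) = 0" "0 \<le> (\<Sum>s\<in>S. l s * f s)"
proof -
  define U where "U = E \<inter> sphere 0 1"
  define C where "C = convex hull ((\<lambda>u. (u, f u)) ` U)"
  define R where "R = {0 :: 'a} \<times> {0 :: real..}"
  have U: "compact U"
    unfolding U_def using assms(1) by (intro closed_Int_compact closed_subspace) auto
  obtain e where e: "e \<in> E" "e \<noteq> 0" using assms(1,2) subspace_0 by blast
  define e' where "e' = (1 / norm e) *\<^sub>R e"
  have e': "e' \<in> U" "- e' \<in> U"
    using e assms(1) by (auto simp: U_def e'_def subspace_scale subspace_neg)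
  have compactC: "compact C"
    unfolding C_def
    by (intro compact_convex_hull compact_continuous_image U continuous_intros
        continuous_on_subset[OF assms(3)]) auto
  show thesis
  proof (cases "C \<inter> R = {}")
    case True
    have "\<exists>a b. (\<forall>x\<in>C. a \<bullet> x < b) \<and> (\<forall>x\<in>R. b < a \<bullet> x)"
    proof (rule separating_hyperplane_compact_closed)
      show "convex R" "closed R" unfolding R_def by (auto intro: convex_Times closed_Times)
      show "C \<noteq> {}" using e' by (auto simp: C_def)
    qed (use compactC True in \<open>auto simp: C_def\<close>)
    then obtain a1 a2 b where a: "\<forall>x\<in>C. (a1, a2) \<bullet> x < b" "\<forall>x\<in>R. b < (a1, a2) \<bullet> x"
      by (metis surj_pair)
    have ray: "b < a2 * t" if "0 \<le> t" for t
    proof -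
      have "(0, t) \<in> R" using that by (simp add: R_def)
      with a(2) have "b < (a1, a2) \<bullet> (0, t)" by blast
      then show ?thesis by simp
    qed
    have b0: "b < 0" using ray[of 0] by simp
    have sph: "a1 \<bullet> u + a2 * f u < b" if "u \<in> U" for u
    proof -
      have "(u, f u) \<in> C" unfolding C_def using that by (intro hull_inc) blast
      with a(1) have "(a1, a2) \<bullet> (u, f u) < b" by blast
      then show ?thesis by simp
    qed
    have "0 \<le> a2"
    proof (rule ccontr)
      assume "\<not> 0 \<le> a2"
      then have "0 \<le> b / a2" using b0 by (intro divide_nonpos_neg) auto
      from ray[OF this] \<open>\<not> 0 \<le> a2\<close> show False by simp
    qed
    moreover have "a2 \<noteq> 0"
      using sph[OF e'(1)] sph[OF e'(2)] b0 by auto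
    ultimately have a2: "0 < a2" by simp
    show thesis
    proof (rule majorant)
      fix u assume "u \<in> E" "norm u = 1"
      then have "a1 \<bullet> u + a2 * f u < 0" using sph[of u] b0 by (simp add: U_def)
      then show "f u \<le> ((- 1 / a2) *\<^sub>R a1) \<bullet> u" using a2 by (simp add: field_simps)
    qed
  next
    case False
    then obtain r where r: "(0, r) \<in> C" "0 \<le> r" unfolding R_def by auto
    let ?G = "\<lambda>u. (u, f u)"
    from r(1) obtain P k where P: "finite P" "P \<subseteq> ?G ` U" "\<forall>x\<in>P. 0 \<le> k x" "sum k P = 1"
        "(\<Sum>x\<in>P. k x *\<^sub>R x) = (0, r)"
      unfolding C_def convex_hull_explicit by blast
    obtain S where S: "S \<subseteq> U" "finite S" "P = ?G ` S"
      using finite_subset_image[OF P(1,2)] by blast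
    have inj: "inj_on ?G S" by (rule inj_onI) simp
    have sum_G: "(\<Sum>s\<in>S. k (?G s) *\<^sub>R ?G s) = (0, r)"
      using P(5) unfolding S(3) by (simp add: sum.reindex[OF inj] comp_def)
    show thesis
    proof (rule weights)
      show "S \<subseteq> E - {0}" using S(1) by (auto simp: U_def)
      show "sum (\<lambda>s. k (?G s)) S = 1" using P(4) unfolding S(3) by (simp add: sum.reindex[OF inj] comp_def)
      show "(\<Sum>s\<in>S. k (?G s) *\<^sub>R s) = 0"
        using arg_cong[OF sum_G, of fst] by (simp add: fst_sum)
      show "0 \<le> (\<Sum>s\<in>S. k (?G s) * f s)"
        using arg_cong[OF sum_G, of snd] r(2) by (simp add: snd_sum)
    qed (use S P(3) in auto)
  qed
qed

lemma inner_not_constant: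
  assumes "K \<noteq> {}" "u \<in> direction_space K" "u \<noteq> 0"
  obtains x y where "x \<in> K" "y \<in> K" "u \<bullet> x \<noteq> u \<bullet> y"
proof -
  obtain p where p: "p \<in> K" using assms(1) by blast
  have "\<exists>x\<in>K. u \<bullet> x \<noteq> u \<bullet> p"
  proof (rule ccontr)
    assume "\<not> (\<exists>x\<in>K. u \<bullet> x \<noteq> u \<bullet> p)"
    then have "affine hull K \<subseteq> {x. u \<bullet> x = u \<bullet> p}"
      by (intro hull_minimal affine_hyperplane) auto
    moreover obtain x y where "x \<in> affine hull K" "y \<in> affine hull K" "u = x - y"
      using assms(2) by (auto simp: direction_space_def)
    ultimately have "u \<bullet> x = u \<bullet> p" "u \<bullet> y = u \<bullet> p" "u \<bullet> u = u \<bullet> x - u \<bullet> y"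
      using inner_diff_right[of u x y] by blast+
    then have "u \<bullet> u = 0" by simp
    with assms(3) show False by simp
  qed
  with p that show ?thesis by blast
qed

text \<open>The centre is the point \<open>p\<close> of the affine hull on which every \<open>u\<close> in the direction space takes
  the value \<open>-(x \<bullet> u) / (1 + a)\<close>. For \<open>y\<close> in the set, let \<open>r y\<close> be the point with
  \<open>-(y - p) = a (r y - p)\<close>. Were it outside the set, a separating hyperplane, with its normal
  projected to the direction space, would violate the assumed inequality.\<close>

lemma minkowski_ratio_le_of_majorant:
  fixes K :: "'a::euclidean_space set"
  assumes K: "compact K" "convex K" "p0 \<in> K" "q0 \<in> K" "p0 \<noteq> q0"
    and x: "\<And>u. u \<in> direction_space K \<Longrightarrow> support_function K (- u) \<le> x \<bullet> u + a * support_function K u"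
  shows "\<exists>p\<in>rel_interior K. minkowski_ratio K p \<le> ereal a"
proof -
  let ?h = "support_function K"
  define E where "E = direction_space K"
  have Kne: "K \<noteq> {}" using K by blast
  have E: "subspace E" unfolding E_def using Kne by (rule subspace_direction_space)
  have diff: "y - z \<in> E" if "y \<in> affine hull K" "z \<in> affine hull K" for y z
    unfolding E_def direction_space_def using that by blast
  have inc: "y \<in> affine hull K" if "y \<in> K" for y using that by (rule hull_inc)
  have a1: "1 \<le> a"
  proof -
    define u where "u = q0 - p0"
    have uE: "u \<in> E" "- u \<in> E" "u \<noteq> 0"
      using diff K(3-5) inc E by (auto simp: u_def subspace_neg)
    have "u \<bullet> p0 < u \<bullet> q0"
      using uE(3) inner_gt_zero_iff[of u] by (simp add: u_def inner_diff_right)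
    then have "0 < ?h u + ?h (- u)"
      using inner_le_support_function[OF K(1,4), of u] inner_le_support_function[OF K(1,3), of "- u"]
      by simp
    moreover have "?h u + ?h (- u) \<le> a * (?h u + ?h (- u))"
      using x[of u] x[of "- u"] uE by (simp add: E_def distrib_left)
    ultimately show ?thesis by simp
  qed
  obtain d where d: "d \<in> E" "\<And>u. u \<in> E \<Longrightarrow> u \<bullet> d = u \<bullet> (- (1 / (1 + a)) *\<^sub>R x - p0)"
    using inner_represented_in_subspace[OF E] by metis
  define p where "p = p0 + d"
  have p_hull: "p \<in> affine hull K"
    using affine_hull_eq_direction_space[OF K(3)] d(1) by (auto simp: p_def E_def)
  have p: "(1 + a) * (u \<bullet> p) = - (x \<bullet> u)" if "u \<in> E" for u
    using d(2)[OF that] a1 by (simp add: p_def inner_add_right inner_diff_right inner_commute)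
  define r where "r = (\<lambda>y. p + (1 / a) *\<^sub>R (p - y))"
  have r_in: "r y \<in> K" if y: "y \<in> K" for y
  proof (rule ccontr)
    assume "r y \<notin> K"
    then obtain u0 b0 where u0: "u0 \<bullet> r y < b0" "\<forall>z\<in>K. b0 < u0 \<bullet> z"
      using separating_hyperplane_closed_point[of K "r y"] K compact_imp_closed by blast
    obtain u where u: "u \<in> E" "\<And>z. z \<in> E \<Longrightarrow> z \<bullet> u = z \<bullet> (- u0)"
      using inner_represented_in_subspace[OF E] by metis
    have "r y \<in> affine hull K"
      unfolding r_def using mem_affine_3_minus[OF affine_affine_hull p_hull p_hull inc[OF y]]
      by simp
    have "u \<bullet> z \<le> u \<bullet> r y - (b0 - u0 \<bullet> r y)" if z: "z \<in> K" for z
    proof -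
      have "b0 < u0 \<bullet> z" using u0(2) z by blast
      moreover have "u \<bullet> (z - r y) = - (u0 \<bullet> (z - r y))"
        using u(2)[OF diff[OF inc[OF z] \<open>r y \<in> affine hull K\<close>]] by (simp add: inner_commute)
      ultimately show ?thesis by (simp add: inner_diff_right)
    qed
    then have "?h u \<le> u \<bullet> r y - (b0 - u0 \<bullet> r y)"
      by (rule support_function_least[OF Kne])
    with u0(1) have "?h u < u \<bullet> r y" by simp
    moreover have "u \<bullet> r y \<le> ?h u"
    proof -
      have "a * (u \<bullet> r y) = (1 + a) * (u \<bullet> p) + - u \<bullet> y"
        using a1 by (simp add: r_def inner_add_right inner_diff_right algebra_simps)
      also have "\<dots> \<le> - (x \<bullet> u) + ?h (- u)"
        using p[OF u(1)] inner_le_support_function[OF K(1) y, of "- u"] by simp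
      also have "\<dots> \<le> a * ?h u"
        using x[of u] u(1) by (simp add: E_def)
      finally show ?thesis using a1 by simp
    qed
    ultimately show False by simp
  qed
  obtain c where c: "c \<in> rel_interior K" using K(2) Kne rel_interior_eq_empty by blast
  (* p lies strictly between the relative interior point c and the point r c of K. *)
  have "r c - (1 / (1 + a)) *\<^sub>R (r c - c) \<in> rel_interior K"
    using a1 c rel_interior_subset r_in
    by (intro rel_interior_convex_shrink[OF K(2)]) auto
  moreover have "r c - (1 / (1 + a)) *\<^sub>R (r c - c) = p"
  proof -
    have "r c - c = ((1 + a) / a) *\<^sub>R (p - c)"
      using a1 by (simp add: r_def add_divide_distrib scaleR_add_left)
    then have "(1 / (1 + a)) *\<^sub>R (r c - c) = (1 / a) *\<^sub>R (p - c)"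
      using a1 by simp
    then show ?thesis by (simp add: r_def)
  qed
  ultimately have "p \<in> rel_interior K" by simp
  moreover have "- (y - p) \<in> (\<lambda>x. a *\<^sub>R (x - p)) ` K" if "y \<in> K" for y
    using r_in[OF that] a1 by (intro image_eqI[of _ _ "r y"]) (auto simp: r_def)
  then have "minkowski_ratio K p \<le> ereal a"
    unfolding minkowski_ratio_def using a1 by (intro INF_lower) auto
  ultimately show ?thesis by blast
qed

section \<open>Equality of the two measures\<close>

text \<open>A homothet of \<open>D\<close> covering the set is carried by the reflection in \<open>p\<close>, up to the
  factor \<open>a\<close>, to a homothet of \<open>-D\<close> that covers the set. Degenerate quotients cause
  no harm, as \<open>0 / 0\<close> and \<open>\<infinity> / \<infinity>\<close> are \<open>0\<close> in \<^typ>\<open>ereal\<close>.\<close>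

lemma simplex_ratio_le_minkowski_ratio:
  fixes K D :: "'a::euclidean_space set"
  shows "simplex_ratio D K \<le> minkowski_ratio K p"
  unfolding minkowski_ratio_def
proof (rule INF_greatest, safe)
  fix a :: real
  assume a: "1 \<le> a" and sub: "(\<lambda>x. - (x - p)) ` K \<subseteq> (\<lambda>x. a *\<^sub>R (x - p)) ` K"
  let ?c = "covering_factor D K" and ?c' = "covering_factor (uminus ` D) K"
  have le: "?c' \<le> ereal (a * l)" if l: "0 \<le> l" "K \<subseteq> (\<lambda>m. x + l *\<^sub>R m) ` D" for l x
  proof -
    have "K \<subseteq> (\<lambda>m. (p + a *\<^sub>R (p - x)) + (a * l) *\<^sub>R m) ` uminus ` D"
    proof
      fix y assume "y \<in> K"
      with sub obtain z where z: "z \<in> K" "- (y - p) = a *\<^sub>R (z - p)" by blast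
      from z(1) l(2) obtain m where m: "m \<in> D" "z = x + l *\<^sub>R m" by blast
      have "y = p - a *\<^sub>R (z - p)" using z(2) by (simp add: algebra_simps)
      then have "y = (p + a *\<^sub>R (p - x)) + (a * l) *\<^sub>R (- m)"
        by (simp add: m(2) algebra_simps)
      with m(1) show "y \<in> (\<lambda>m. (p + a *\<^sub>R (p - x)) + (a * l) *\<^sub>R m) ` uminus ` D" by blast
    qed
    with a l(1) show ?thesis
      unfolding covering_factor_def by (intro INF_lower) auto
  qed
  have nonneg: "0 \<le> covering_factor M K" for M
    unfolding covering_factor_def by (intro INF_greatest) auto
  have "?c' / ereal a \<le> ?c"
    unfolding covering_factor_def[of D]
  proof (rule INF_greatest, safe)
    fix l :: real and x assume "0 \<le> l" "K \<subseteq> (\<lambda>m. x + l *\<^sub>R m) ` D"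
    from le[OF this] show "?c' / ereal a \<le> ereal l"
      using a by (simp add: ereal_divide_le_pos)
  qed
  then have c'_le: "?c' \<le> ereal a * ?c"
    using a by (simp add: ereal_divide_le_pos)
  show "simplex_ratio D K \<le> ereal a"
  proof (cases "?c = 0 \<or> ?c = \<infinity>")
    case True
    then have "?c = \<infinity> \<or> ?c' = 0"
      using c'_le nonneg[of "uminus ` D"] by (auto intro: antisym)
    with True show ?thesis
      using a by (auto simp: simplex_ratio_def)
  next
    case False
    with nonneg[of D] have "0 < ?c" "?c \<noteq> \<infinity>" by auto
    with c'_le show ?thesis
      by (simp add: simplex_ratio_def ereal_divide_le_pos mult.commute)
  qed
qed

text \<open>The two alternatives of the duality, applied to \<open>h(-u) - a h(u)\<close>. The gap between \<open>b\<close> and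
  \<open>a\<close> absorbs the limiting cases: the balanced directions come with a weak inequality only, and
  the simplex built from them needs a strict one.\<close>

lemma exists_center_or_simplex:
  fixes K :: "'a::euclidean_space set"
  assumes K: "compact K" "convex K" "p \<in> K" "q \<in> K" "p \<noteq> q" and "b < a"
  obtains (center) c where "c \<in> rel_interior K" "minkowski_ratio K c \<le> ereal a"
  | (simplex) D where "D \<in> centered_simplices K" "ereal b < simplex_ratio D K"
proof -
  let ?h = "support_function K"
  let ?E = "direction_space K"
  have Kne: "K \<noteq> {}" using K by blast
  have E: "subspace ?E" using Kne by (rule subspace_direction_space)
  have "p - q \<in> ?E"
    unfolding direction_space_def using K(3,4) hull_inc[of _ K affine] by blast
  moreover have "p - q \<noteq> 0" using K(5) by simp
  ultimately have E0: "?E \<noteq> {0}" by (metis singletonD)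
  have "continuous_on UNIV (\<lambda>u. ?h (- u) - a * ?h u)"
    by (intro continuous_intros continuous_on_compose2[OF continuous_on_support_function[OF K(1) Kne]]) auto
  from E E0 this show thesis
  proof (cases rule: linear_majorant_or_balanced_weights)
    case (majorant x)
    have "?h (- u) \<le> x \<bullet> u + a * ?h u" if "u \<in> ?E" for u
    proof (cases "u = 0")
      case True
      have "?h 0 = 0" using support_function_scaleR[OF K(1) Kne, of 0 0] by simp
      with True show ?thesis by simp
    next
      case False
      define e where "e = (1 / norm u) *\<^sub>R u"
      have u: "u = norm u *\<^sub>R e" using False by (simp add: e_def)
      have "?h (- e) \<le> x \<bullet> e + a * ?h e"
        using majorant[of e] that False E by (simp add: e_def subspace_scale)
      then have "norm u * ?h (- e) \<le> norm u * (x \<bullet> e + a * ?h e)"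
        by (rule mult_left_mono) simp
      moreover have "?h u = norm u * ?h e" "?h (- u) = norm u * ?h (- e)" "x \<bullet> u = norm u * (x \<bullet> e)"
        using support_function_scaleR[OF K(1) Kne, of "norm u" e]
          support_function_scaleR[OF K(1) Kne, of "norm u" "- e"]
        by (simp_all flip: u add: scaleR_minus_right) (metis u inner_scaleR_right)
      ultimately show ?thesis by (simp add: algebra_simps)
    qed
    from minkowski_ratio_le_of_majorant[OF K this] show thesis using center by blast
  next
    case (weights S l)
    obtain s where s: "s \<in> S" "l s \<noteq> 0" using weights(4) by (metis sum.neutral zero_neq_one)
    obtain y z where yz: "y \<in> K" "z \<in> K" "s \<bullet> y \<noteq> s \<bullet> z"
      using inner_not_constant[OF Kne, of s] s(1) weights(2) by blast
    have "0 < (\<Sum>s\<in>S. ?h (l s *\<^sub>R s))"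
      using s yz weights(1,5) by (intro support_function_sum_pos[OF K(1), of _ _ s y z]) auto
    also have "\<dots> = (\<Sum>s\<in>S. l s * ?h s)"
      using weights(3) by (intro sum.cong support_function_scaleR[OF K(1) Kne]) auto
    (* Lowering a to b makes the weak inequality strict. *)
    finally have "0 < (a - b) * (\<Sum>s\<in>S. l s * ?h s)" using \<open>b < a\<close> by simp
    also have "\<dots> \<le> (\<Sum>s\<in>S. l s * (?h (- s) - a * ?h s)) + (a - b) * (\<Sum>s\<in>S. l s * ?h s)"
      using weights(6) by simp
    also have "\<dots> = (\<Sum>s\<in>S. l s * (?h (- s) - b * ?h s))"
      by (simp add: sum_distrib_left algebra_simps flip: sum.distrib)
    finally have gap: "0 < (\<Sum>s\<in>S. l s * (?h (- s) - b * ?h s))" .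
    have "S \<subseteq> ?E" using weights(2) by blast
    from exists_simplex_with_large_ratio[OF K(1,3,4,5) weights(1) this weights(3-5) gap]
    show thesis using simplex by blast
  qed
qed

theorem theorem2:
  fixes K :: "(real ^ 'n) set"
  assumes "compact K" and "convex K" and "K \<noteq> {}" and "\<not> (\<exists>x. K = {x})"
  shows "simplex_measure K = minkowski_measure K"
proof (rule antisym)
  show "simplex_measure K \<le> minkowski_measure K"
    unfolding simplex_measure_def minkowski_measure_def
    by (intro SUP_least INF_greatest simplex_ratio_le_minkowski_ratio)
  obtain p q where pq: "p \<in> K" "q \<in> K" "p \<noteq> q"
    using assms(3,4) by blast
  show "minkowski_measure K \<le> simplex_measure K"
  proof (rule ccontr)
    assume "\<not> minkowski_measure K \<le> simplex_measure K"
    then obtain a where a: "simplex_measure K < ereal a" "ereal a < minkowski_measure K"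
      using ereal_dense2[of "simplex_measure K" "minkowski_measure K"] by (auto simp: not_le)
    then obtain b where b: "simplex_measure K < ereal b" "b < a"
      using ereal_dense2[of "simplex_measure K" "ereal a"] by auto
    from assms(1,2) pq b(2) show False
    proof (cases rule: exists_center_or_simplex)
      case (center c)
      then have "minkowski_measure K \<le> ereal a"
        unfolding minkowski_measure_def by (meson INF_lower2)
      with a(2) show False by simp
    next
      case (simplex D)
      then have "ereal b < simplex_measure K"
        unfolding simplex_measure_def by (meson SUP_upper less_le_trans)
      with b(1) show False by simp
    qed
  qed
qed

end
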